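(* Let $\Omega\subset\mathbb{R}^2$ be a rational polygon with associated integers $p$ and $M$, let $\alpha_1,\dots,\alpha_M\in[0,2\pi)$ be distinct canonical incident angles, let $(\theta,\alpha)\in[0,2\pi)^2$, and let $\mathbf{b}=[b_1(\alpha),\dots,b_M(\alpha)]^T\in\mathbb{C}^M$ be exact embedding coefficients for $\alpha$. Let $\theta_0,\theta_0'$ be the nearby poles associated with $(\theta,\alpha)$. Suppose the approximations $D_N(\cdot,\alpha_m)$, $m=1,\dots,M$, satisfy $$|D(z,\alpha_m)-D_N(z,\alpha_m)|\le \epsilon_m,\qquad z\in\Psi,\ m=1,\dots,M,$$ where $\Psi:=\{z\in\mathbb{C}:|\operatorname{Im} z|<\ln(3+\pi^2/64)/p\}$ and $\epsilon_1,\dots,\epsilon_M$ are ($N$-dependent) constants. Then there exists a closed rectangular contour $\gamma$ in $\mathbb{C}$ (oriented anti-clockwise) enclosing $\theta$, $\theta_0$ and $\theta_0'$, such that $$\left|D(\theta,\alpha)-\mathcal{D}_N(\theta,\alpha;\gamma)\right|\le C\|\epsilon\|_2,$$ where $\|\epsilon\|_2:=\sqrt{\sum_{m=1}^M|\epsilon_m|^2}$ and $$C:=\frac{128\left(5\pi+4\ln(3+\pi^2/64)\right)\left(6+\pi^2/64\right)}{\pi^4}\,\|\mathbf{b}\|_2 .$$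
   Context: Rational polygon: an $S$-sided polygon $\Omega\subset\mathbb{R}^2$ whose external angles $\omega_1,\dots,\omega_S$ are all rational multiples of $\pi$ (convexity is not required; a screen $[0,1]\times\{0\}$, with two external angles $2\pi$, is allowed). $p$ is the smallest positive integer such that $\pi/p$ divides every $\omega_j$ exactly, $q_j$ are the integers with $\omega_j=q_j\pi/p$, and $M:=\sum_{j=1}^S(q_j-1)$. One edge of $\Omega$ is assumed to be aligned with the horizontal axis. Far-field pattern: fix a wavenumber $k>0$. For $\alpha\in[0,2\pi)$ let $u^i(\mathbf{x};\alpha)=e^{-ik(x_1\cos\alpha+x_2\sin\alpha)}$ and let $u^s(\cdot;\alpha)$ be the solution of $(\Delta+k^2)u^s=0$ in $\mathbb{R}^2\setminus\Omega$, $u^s=-u^i$ on $\partial\Omega$, with the Sommerfeld radiation condition $\partial u^s/\partial r-iku^s=o(r^{-1/2})$ as $r=|\mathbf{x}|\to\infty$. The far-field pattern $D(\theta,\alpha)$ is defined by $u^s(\mathbf{x};\alpha)=\frac{e^{i(kr+\pi/4)}}{\sqrt{2\pi kr}}\left(D(\theta,\alpha)+\mathcal{O}(r^{-1})\right)$ as $r\to\infty$, $\mathbf{x}=r(\cos\theta,\sin\theta)$. It is well known that $D(\cdot,\alpha)$ extends to an entire, $2\pi$-periodic function of the observation angle; $D(z,\alpha)$ for complex $z$ denotes this extension. Notation: $\Lambda(z,\alpha):=\cos(pz)-(-1)^p\cos(p\alpha)$. Exact embedding coefficients for $\alpha$: numbers $b_m(\alpha)\in\mathbb{C}$ such that $\Lambda(\theta,\alpha)D(\theta,\alpha)=\sum_{m=1}^M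 b_m(\alpha)\Lambda(\theta,\alpha_m)D(\theta,\alpha_m)$ for all $\theta$ (it is assumed that these exist and are known exactly). Approximations: $D_N(\cdot,\alpha_m)$ are given complex-valued (Borel measurable) functions on $\Psi$, and for a closed contour $\gamma$ around $\theta$, $$\mathcal{D}_N(\theta,\alpha;\gamma):=\frac{1}{2\pi i}\oint_\gamma\frac{\sum_{m=1}^M b_m(\alpha)\Lambda(z,\alpha_m)D_N(z,\alpha_m)}{\Lambda(z,\alpha)(z-\theta)}\,dz .$$ Nearby poles: $\Theta_\alpha:=\{\theta\in\mathbb{C}:\Lambda(\theta,\alpha)=0\}$, which is a subset of $\mathbb{R}$, and $|\theta-\theta'|_{2\pi}:=\min_{n\in\mathbb{Z}}|\theta-\theta'+2n\pi|$. $\theta_0$ is an element of $\Theta_\alpha$ minimising $|\theta-\tilde\theta_0|_{2\pi}$ over $\tilde\theta_0\in\Theta_\alpha$. If $\theta_0\in\{n\pi/p:n\in\mathbb{Z}\}$ then $\theta_0':=\theta_0$; otherwise $\theta_0'$ is an element of $\Theta_\alpha$, different from $\theta_0$ modulo $2\pi$, minimising $|\theta_0-\tilde\theta_0'|_{2\pi}$. Angles are understood modulo $2\pi$; representatives in $\mathbb{R}$ are taken so that $|\theta-\theta_0|=|\theta-\theta_0|_{2\pi}$ and $|\theta_0-\theta_0'|=|\theta_0-\theta_0'|_{2\pi}$. *)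

theory Defs
  imports "HOL-Complex_Analysis.Complex_Analysis" "HOL-Library.Landau_Symbols"
begin

text \<open>
  The Euclidean plane is represented by the type \<^typ>\<open>complex\<close>: the point (x1, x2) is x1 + i x2.
\<close>

subsection \<open>Rational polygons\<close>

text \<open>
  A polygon is given by the list of its vertices; vertex indices are cyclic.
\<close>

definition vertex :: "complex list \<Rightarrow> nat \<Rightarrow> complex" where
  "vertex vs j = vs ! (j mod length vs)"

definition edge :: "complex list \<Rightarrow> nat \<Rightarrow> complex set" where
  "edge vs j = closed_segment (vertex vs j) (vertex vs (Suc j))"

definition polygon_boundary :: "complex list \<Rightarrow> complex set" where
  "polygon_boundary vs = (\<Union>j<length vs. edge vs j)"

text \<open>
  The closed region bounded by the edges. For two vertices (a screen) the inside is empty and the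
  region is the segment joining them.
\<close>

definition polygon_region :: "complex list \<Rightarrow> complex set" where
  "polygon_region vs = polygon_boundary vs \<union> inside (polygon_boundary vs)"

text \<open>
  The vertices are listed anticlockwise, so the subtracted argument, in [0, 2 pi), is the angle
  on the inner side of the vertex: it is swept anticlockwise from the outgoing edge to the edge
  shared with the preceding vertex. For a screen it is 0, and both external angles are 2 pi.
\<close>

definition ext_angle :: "complex list \<Rightarrow> nat \<Rightarrow> real" where
  "ext_angle vs j = 2 * pi -
     Arg2pi ((vertex vs (j + length vs - 1) - vertex vs j) / (vertex vs (Suc j) - vertex vs j))"

text \<open>
  Either a screen, or a simple closed polygonal line: distinct edges meet only in common end
  points, no vertex is straight, and twice the signed area (shoelace formula) is positive, which
  expresses the anticlockwise orientation.
\<close>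

definition is_polygon :: "complex list \<Rightarrow> bool" where
  "is_polygon vs \<longleftrightarrow> distinct vs \<and>
     (length vs = 2 \<or>
      length vs \<ge> 3 \<and>
      (\<forall>i<length vs. \<forall>j<length vs. i \<noteq> j \<longrightarrow>
         edge vs i \<inter> edge vs j = {vertex vs i, vertex vs (Suc i)} \<inter> {vertex vs j, vertex vs (Suc j)}) \<and>
      (\<forall>j<length vs. ext_angle vs j \<noteq> pi) \<and>
      (\<Sum>j<length vs. Im (cnj (vertex vs j) * vertex vs (Suc j))) > 0)"

definition rational_polygon :: "complex list \<Rightarrow> bool" where
  "rational_polygon vs \<longleftrightarrow> is_polygon vs \<and> (\<forall>j<length vs. ext_angle vs j / pi \<in> \<rat>)"

definition has_horizontal_edge :: "complex list \<Rightarrow> bool" where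
  "has_horizontal_edge vs \<longleftrightarrow> (\<exists>j<length vs. Im (vertex vs j) = Im (vertex vs (Suc j)))"

definition angle_denom :: "complex list \<Rightarrow> nat" where
  "angle_denom vs =
     (LEAST p. 0 < p \<and> (\<forall>j<length vs. \<exists>q::int. ext_angle vs j = of_int q * (pi / real p)))"

definition angle_num :: "complex list \<Rightarrow> nat \<Rightarrow> int" where
  "angle_num vs j = (THE q. ext_angle vs j = of_int q * pi / real (angle_denom vs))"


subsection \<open>The scattering problem and its far-field pattern\<close>

definition incident_wave :: "real \<Rightarrow> real \<Rightarrow> complex \<Rightarrow> complex" where
  "incident_wave k \<alpha> x =
     exp (- \<i> * of_real k * of_real (Re x * cos \<alpha> + Im x * sin \<alpha>))"

definition dir_deriv :: "'a::real_normed_vector \<Rightarrow> ('a \<Rightarrow> complex) \<Rightarrow> 'a \<Rightarrow> complex" where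
  "dir_deriv h u x = vector_derivative (\<lambda>t. u (x + t *\<^sub>R h)) (at 0)"

definition laplacian :: "('a::euclidean_space \<Rightarrow> complex) \<Rightarrow> 'a \<Rightarrow> complex" where
  "laplacian u x = (\<Sum>e\<in>Basis. dir_deriv e (dir_deriv e u) x)"

text \<open>Twice continuously (real) differentiable functions on an open set.\<close>

definition C2_on :: "'a::euclidean_space set \<Rightarrow> ('a \<Rightarrow> complex) \<Rightarrow> bool" where
  "C2_on E u \<longleftrightarrow> u differentiable_on E \<and>
     (\<forall>e\<in>Basis. dir_deriv e u differentiable_on E) \<and>
     (\<forall>e\<in>Basis. \<forall>e'\<in>Basis. continuous_on E (dir_deriv e' (dir_deriv e u)))"

text \<open>
  Classical solutions of the sound-soft exterior problem, continuous up to the boundary. At a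
  point x other than the origin the radial direction is \<^term>\<open>sgn x\<close>, the unit vector x / |x|.
\<close>

definition scattered_field ::
    "real \<Rightarrow> complex set \<Rightarrow> real \<Rightarrow> (complex \<Rightarrow> complex) \<Rightarrow> bool" where
  "scattered_field k \<Omega> \<alpha> u \<longleftrightarrow>
     C2_on (- \<Omega>) u \<and> continuous_on (closure (- \<Omega>)) u \<and>
     (\<forall>x\<in>- \<Omega>. laplacian u x + of_real (k\<^sup>2) * u x = 0) \<and>
     (\<forall>x\<in>frontier \<Omega>. u x = - incident_wave k \<alpha> x) \<and>
     (\<lambda>x. dir_deriv (sgn x) u x - \<i> * of_real k * u x)
        \<in> o[at_infinity](\<lambda>x. of_real (norm x powr (-1/2)))"

definition has_far_field :: "real \<Rightarrow> (complex \<Rightarrow> complex) \<Rightarrow> (real \<Rightarrow> complex) \<Rightarrow> bool" where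
  "has_far_field k u d \<longleftrightarrow>
     (\<forall>\<theta>. \<exists>R. R \<in> O[at_top](\<lambda>r. of_real (1 / r)) \<and>
        (\<forall>\<^sub>F r in at_top. u (of_real r * cis \<theta>) =
           exp (\<i> * of_real (k * r + pi / 4)) / of_real (sqrt (2 * pi * k * r)) * (d \<theta> + R r)))"


subsection \<open>Embedding formulae\<close>

definition \<Lambda> :: "nat \<Rightarrow> complex \<Rightarrow> real \<Rightarrow> complex" where
  "\<Lambda> p z \<alpha> = cos (of_nat p * z) - (-1) ^ p * of_real (cos (real p * \<alpha>))"

definition \<Theta> :: "nat \<Rightarrow> real \<Rightarrow> complex set" where
  "\<Theta> p \<alpha> = {z. \<Lambda> p z \<alpha> = 0}"

definition \<Psi> :: "nat \<Rightarrow> complex set" where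
  "\<Psi> p = {z. \<bar>Im z\<bar> < ln (3 + pi\<^sup>2 / 64) / real p}"

text \<open>The distance modulo 2 pi; the infimum is attained.\<close>

definition dist_2pi :: "complex \<Rightarrow> complex \<Rightarrow> real" where
  "dist_2pi z w = (INF n::int. cmod (z - w + 2 * of_int n * of_real pi))"

definition embedding_coeffs ::
    "nat \<Rightarrow> nat \<Rightarrow> (complex \<Rightarrow> real \<Rightarrow> complex) \<Rightarrow> (nat \<Rightarrow> real) \<Rightarrow> real \<Rightarrow> (nat \<Rightarrow> complex) \<Rightarrow> bool" where
  "embedding_coeffs p M D am \<alpha> b \<longleftrightarrow>
     (\<forall>\<theta>::real. \<Lambda> p (of_real \<theta>) \<alpha> * D (of_real \<theta>) \<alpha> =
        (\<Sum>m=1..M. b m * \<Lambda> p (of_real \<theta>) (am m) * D (of_real \<theta>) (am m)))"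

definition embedding_integrand ::
    "nat \<Rightarrow> nat \<Rightarrow> (complex \<Rightarrow> real \<Rightarrow> complex) \<Rightarrow> (nat \<Rightarrow> real) \<Rightarrow> (nat \<Rightarrow> complex)
       \<Rightarrow> real \<Rightarrow> real \<Rightarrow> complex \<Rightarrow> complex" where
  "embedding_integrand p M D\<^sub>N am b \<theta> \<alpha> z =
     (\<Sum>m=1..M. b m * \<Lambda> p z (am m) * D\<^sub>N z (am m)) / (\<Lambda> p z \<alpha> * (z - of_real \<theta>))"

definition embedding_approx ::
    "nat \<Rightarrow> nat \<Rightarrow> (complex \<Rightarrow> real \<Rightarrow> complex) \<Rightarrow> (nat \<Rightarrow> real) \<Rightarrow> (nat \<Rightarrow> complex)
       \<Rightarrow> real \<Rightarrow> real \<Rightarrow> (real \<Rightarrow> complex) \<Rightarrow> complex" where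
  "embedding_approx p M D\<^sub>N am b \<theta> \<alpha> \<gamma> =
     1 / (2 * of_real pi * \<i>) * contour_integral \<gamma> (embedding_integrand p M D\<^sub>N am b \<theta> \<alpha>)"

text \<open>
  The poles are real. The reals \<open>\<theta>\<^sub>0\<close> and \<open>\<theta>\<^sub>0'\<close> are representatives modulo 2 pi whose ordinary
  distances realise the distances modulo 2 pi.
\<close>

definition nearby_poles :: "nat \<Rightarrow> real \<Rightarrow> real \<Rightarrow> real \<Rightarrow> real \<Rightarrow> bool" where
  "nearby_poles p \<theta> \<alpha> \<theta>\<^sub>0 \<theta>\<^sub>0' \<longleftrightarrow>
     of_real \<theta>\<^sub>0 \<in> \<Theta> p \<alpha> \<and>
     (\<forall>t\<in>\<Theta> p \<alpha>. dist_2pi (of_real \<theta>) (of_real \<theta>\<^sub>0) \<le> dist_2pi (of_real \<theta>) t) \<and>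
     \<bar>\<theta> - \<theta>\<^sub>0\<bar> = dist_2pi (of_real \<theta>) (of_real \<theta>\<^sub>0) \<and>
     (if \<exists>n::int. \<theta>\<^sub>0 = of_int n * pi / real p then \<theta>\<^sub>0' = \<theta>\<^sub>0
      else let others = {t \<in> \<Theta> p \<alpha>. \<forall>n::int. t \<noteq> of_real (\<theta>\<^sub>0 + 2 * of_int n * pi)} in
        of_real \<theta>\<^sub>0' \<in> others \<and>
        (\<forall>t\<in>others. dist_2pi (of_real \<theta>\<^sub>0) (of_real \<theta>\<^sub>0') \<le> dist_2pi (of_real \<theta>\<^sub>0) t) \<and>
        \<bar>\<theta>\<^sub>0 - \<theta>\<^sub>0'\<bar> = dist_2pi (of_real \<theta>\<^sub>0) (of_real \<theta>\<^sub>0'))"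

end

theory Submission
  imports Defs
begin

text \<open>
  By analytic continuation the embedding formula holds for all complex observation angles, so
  Cauchy's formula for the entire function \<open>D(\<cdot>, \<alpha>)\<close> turns the error into the contour integral of
  \<open>\<Sum>m. b\<^sub>m \<Lambda>(z, \<alpha>\<^sub>m) (D - D\<^sub>N)(z, \<alpha>\<^sub>m)\<close> divided by \<open>\<Lambda>(z, \<alpha>) (z - \<theta>)\<close>. Cauchy-Schwarz reduces the
  claim to choosing a rectangle on which this denominator is bounded below. Both \<open>\<theta>\<close> and the second
  pole lie within \<open>\<pi> / p\<close> of \<open>\<theta>\<^sub>0\<close>, since the poles are \<open>\<plusminus>\<theta>\<^sub>0\<close> shifted by multiples of \<open>2 \<pi> / p\<close>.
\<close>

section \<open>Estimates for the complex cosine\<close>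

lemma cosh_one_bounds: "17/12 \<le> cosh (1::real)" "cosh (1::real) \<le> 5/3"
proof -
  have 1: "5/2 \<le> exp (1::real)"
    using exp_lower_Taylor_quadratic[of 1] by simp
  have 2: "exp (1::real) \<le> 3" by (rule exp_le)
  have "1/3 \<le> exp (-1::real)" "exp (-1::real) \<le> 2/5"
    using 1 2 by (simp_all add: exp_minus field_simps)
  moreover have "exp 1 + exp (-1::real) \<le> 10/3"
  proof -
    \<comment> \<open>On [1/3, 3] the map x + 1/x is at most 10/3; this product is that bound with
      denominators cleared.\<close>
    have "(3 - exp (1::real)) * (exp 1 - 1/3) \<ge> 0"
      using 1 2 by simp
    then have "exp (1::real) * exp 1 + 1 \<le> 10/3 * exp 1"
      by (simp add: algebra_simps)
    then show ?thesis by (simp add: exp_minus field_simps)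
  qed
  ultimately show "17/12 \<le> cosh (1::real)" "cosh (1::real) \<le> 5/3"
    using 1 by (simp_all add: cosh_def)
qed

lemma Re_cos_cosh: "Re (cos z) = cos (Re z) * cosh (Im z)"
  by (simp add: Re_cos cosh_def)

lemma Im_cos_sinh: "Im (cos z) = - (sin (Re z) * sinh (Im z))"
  by (simp add: Im_cos sinh_def field_simps)

lemma cmod_cos_le_cosh: "cmod (cos z) \<le> cosh (Im z)"
proof (rule power2_le_imp_le)
  have "(cmod (cos z))\<^sup>2 = (cos (Re z))\<^sup>2 * (cosh (Im z))\<^sup>2 + (sin (Re z))\<^sup>2 * (sinh (Im z))\<^sup>2"
    by (simp add: cmod_power2 Re_cos_cosh Im_cos_sinh power_mult_distrib)
  also have "\<dots> = (cosh (Im z))\<^sup>2 - (sin (Re z))\<^sup>2"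
    by (simp add: cos_squared_eq sinh_square_eq algebra_simps)
  finally show "(cmod (cos z))\<^sup>2 \<le> (cosh (Im z))\<^sup>2" by simp
qed (simp add: order_trans[OF _ cosh_real_ge_1])

text \<open>With |cos z| >= |sinh (Im z)|, the triangle inequality gives only |sinh (Im z)| - 1. The
  sharper bound holds because the difference of the squares is (x - c)^2 + 2 (C - 1) (1 - c x), a
  sum of nonnegative terms.\<close>

lemma cmod_cos_diff_ge_cosh:
  assumes "\<bar>c\<bar> \<le> 1"
  shows "cosh (Im z) - 1 \<le> cmod (cos z - of_real c)"
proof (rule power2_le_imp_le)
  define C x where "C = cosh (Im z)" and "x = cos (Re z)"
  have C: "C \<ge> 1" by (simp add: C_def cosh_real_ge_1)
  have "\<bar>c * x\<bar> \<le> 1"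
    using assms by (simp add: abs_mult mult_le_one x_def)
  then have "0 \<le> (x - c)\<^sup>2 + 2 * (C - 1) * (1 - c * x)"
    using C by (intro add_nonneg_nonneg mult_nonneg_nonneg) auto
  also have "\<dots> = (x * C - c)\<^sup>2 + (1 - x\<^sup>2) * (C\<^sup>2 - 1) - (C - 1)\<^sup>2"
    by (simp add: power2_eq_square algebra_simps)
  also have "(x * C - c)\<^sup>2 + (1 - x\<^sup>2) * (C\<^sup>2 - 1) = (cmod (cos z - of_real c))\<^sup>2"
    by (simp add: cmod_power2 Re_cos_cosh Im_cos_sinh power_mult_distrib C_def x_def
        sin_squared_eq sinh_square_eq)
  finally show "(cosh (Im z) - 1)\<^sup>2 \<le> (cmod (cos z - of_real c))\<^sup>2"
    by (simp add: C_def)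
qed simp

text \<open>On such a vertical line \<open>cos z\<close> is real with absolute value
  \<open>cosh (Im z)\<close>, and \<open>c\<close> is zero or of the opposite sign, so subtracting
  it cannot reduce the modulus.\<close>

lemma cmod_cos_diff_ge_one:
  assumes "\<bar>cos (Re z)\<bar> = 1" "cos (Re z) * c \<le> 0"
  shows "1 \<le> cmod (cos z - of_real c)"
proof -
  have "cosh (Im z) \<ge> 1" by (rule cosh_real_ge_1)
  then have "1 \<le> \<bar>cos (Re z) * cosh (Im z) - c\<bar>"
    using assms by (auto simp: abs_if split: if_splits)
  also have "\<dots> = \<bar>Re (cos z - of_real c)\<bar>" by (simp add: Re_cos_cosh)
  also have "\<dots> \<le> cmod (cos z - of_real c)" by (rule abs_Re_le_cmod)
  finally show ?thesis .
qed

lemma cos_plus_of_int_2pi: "cos (t + of_int n * (2 * pi)) = cos t"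
  using sin_integer_2pi[of "of_int n"] cos_integer_2pi[of "of_int n"]
  by (simp add: cos_add mult_ac)

text \<open>Supplies the positions of the vertical sides of the contour.\<close>

lemma cos_eq_in_period: "\<exists>u\<in>{y..y + 2 * pi}. cos u = cos (t::real)"
proof
  define n where "n = \<lceil>(y - t) / (2 * pi)\<rceil>"
  show "cos (t + of_int n * (2 * pi)) = cos t" by (rule cos_plus_of_int_2pi)
  have "(y - t) / (2 * pi) \<le> of_int n" "of_int n \<le> (y - t) / (2 * pi) + 1"
    unfolding n_def by linarith+
  then show "t + of_int n * (2 * pi) \<in> {y..y + 2 * pi}"
    by (simp add: field_simps)
qed

section \<open>Integration along rectangles and analytic continuation\<close>

text \<open>The approximations are only Borel measurable, so integrability cannot come from
  continuity; a bounded measurable function on a compact parameter interval suffices.\<close>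

lemma contour_integrable_linepath_bounded:
  assumes f: "f \<in> borel_measurable (restrict_space borel A)"
    and A: "closed_segment a b \<subseteq> A"
    and B: "\<And>z. z \<in> closed_segment a b \<Longrightarrow> norm (f z) \<le> B"
  shows "f contour_integrable_on linepath a b"
proof -
  have seg: "linepath a b t \<in> closed_segment a b" if "t \<in> {0..1}" for t
    using that linepath_in_path by blast
  have "linepath a b \<in> measurable (lebesgue_on {0..1}) (restrict_space borel A)"
  proof (rule measurable_restrict_space2)
    show "linepath a b \<in> space (lebesgue_on {0..1}) \<rightarrow> A"
      using seg A by auto
    show "linepath a b \<in> borel_measurable (lebesgue_on {0..1})"
      by (intro continuous_imp_measurable_on_sets_lebesgue continuous_on_linepath) auto
  qed
  from measurable_compose[OF this f]
  have "(\<lambda>t. f (linepath a b t) * (b - a)) \<in> borel_measurable (lebesgue_on {0..1})"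
    by (intro borel_measurable_times) (auto simp: o_def)
  then have "(\<lambda>t. f (linepath a b t) * (b - a)) integrable_on {0..1}"
  proof (rule measurable_bounded_by_integrable_imp_integrable)
    show "(\<lambda>t::real. B * norm (b - a)) integrable_on {0..1}" by (rule integrable_const_ivl)
    show "norm (f (linepath a b t) * (b - a)) \<le> B * norm (b - a)" if "t \<in> {0..1}" for t
      using B[OF seg[OF that]] by (simp add: norm_mult mult_right_mono)
  qed auto
  then show ?thesis by (simp add: contour_integrable_on)
qed

lemma contour_integral_rectpath_bounded:
  assumes f: "f \<in> borel_measurable (restrict_space borel A)"
    and A: "path_image (rectpath a c) \<subseteq> A"
    and B: "\<And>z. z \<in> path_image (rectpath a c) \<Longrightarrow> norm (f z) \<le> B"
  shows "f contour_integrable_on rectpath a c"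
    and "norm (contour_integral (rectpath a c) f)
           \<le> B * (2 * \<bar>Re c - Re a\<bar> + 2 * \<bar>Im c - Im a\<bar>)"
proof -
  define a2 a4 where "a2 = Complex (Re c) (Im a)" and "a4 = Complex (Re a) (Im c)"
  have rect: "rectpath a c = linepath a a2 +++ linepath a2 c +++ linepath c a4 +++ linepath a4 a"
    by (simp add: rectpath_def a2_def a4_def Let_def)
  have image: "path_image (rectpath a c) = closed_segment a a2 \<union> closed_segment a2 c
      \<union> closed_segment c a4 \<union> closed_segment a4 a"
    unfolding rect by (simp add: path_image_join Un_assoc)
  have "a \<in> path_image (rectpath a c)" using image by auto
  then have "B \<ge> 0" using B norm_ge_zero order_trans by blast
  have i: "f contour_integrable_on linepath x y"
    if "closed_segment x y \<subseteq> path_image (rectpath a c)" for x y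
    using that A B by (intro contour_integrable_linepath_bounded[OF f]) auto
  have n: "norm (contour_integral (linepath x y) f) \<le> B * norm (y - x)"
    if "closed_segment x y \<subseteq> path_image (rectpath a c)" for x y
    using that B \<open>B \<ge> 0\<close> i by (intro contour_integral_bound_linepath) auto
  have sub: "closed_segment a a2 \<subseteq> path_image (rectpath a c)"
    "closed_segment a2 c \<subseteq> path_image (rectpath a c)"
    "closed_segment c a4 \<subseteq> path_image (rectpath a c)"
    "closed_segment a4 a \<subseteq> path_image (rectpath a c)"
    using image by auto
  note I = sub[THEN i] and N = sub[THEN n]
  show "f contour_integrable_on rectpath a c"
    using I by (simp add: rect)
  have len: "norm (a2 - a) = \<bar>Re c - Re a\<bar>" "norm (c - a2) = \<bar>Im c - Im a\<bar>"
    "norm (a4 - c) = \<bar>Re c - Re a\<bar>" "norm (a - a4) = \<bar>Im c - Im a\<bar>"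
    by (simp_all add: cmod_def a2_def a4_def abs_minus_commute)
  have "contour_integral (rectpath a c) f = contour_integral (linepath a a2) f +
     (contour_integral (linepath a2 c) f + (contour_integral (linepath c a4) f +
      contour_integral (linepath a4 a) f))"
    using I by (simp add: rect)
  also have "norm \<dots> \<le> B * norm (a2 - a) + (B * norm (c - a2) + (B * norm (a4 - c) + B * norm (a - a4)))"
    by (intro norm_triangle_mono N)
  also have "\<dots> = B * (2 * \<bar>Re c - Re a\<bar> + 2 * \<bar>Im c - Im a\<bar>)"
    by (simp add: len algebra_simps)
  finally show "norm (contour_integral (rectpath a c) f)
           \<le> B * (2 * \<bar>Re c - Re a\<bar> + 2 * \<bar>Im c - Im a\<bar>)" .
qed

text \<open>The path traces the frontier of a bounded convex set, whose inside is the interior of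
  that set.\<close>

lemma inside_path_image_rectpath:
  assumes "Re a < Re c" "Im a < Im c"
  shows "inside (path_image (rectpath a c)) = box a c"
proof -
  have "box a c \<noteq> {}"
    using assms by (simp add: box_ne_empty Basis_complex_def)
  then have "path_image (rectpath a c) = frontier (cbox a c)"
    using assms by (simp add: path_image_rectpath_cbox_minus_box frontier_cbox)
  then show ?thesis
    by (simp add: inside_frontier_eq_interior interior_cbox)
qed

text \<open>To be applied with F the exact far-field pattern, g the computable integrand and h its
  error. Cauchy's formula is applied to the entire F alone, so the zeros of \<Lambda> inside the
  contour require no residues.\<close>

lemma Cauchy_rectpath_perturbed:
  assumes F: "F holomorphic_on UNIV" and \<theta>: "\<theta> \<in> box a c"
    and h: "h \<in> borel_measurable (restrict_space borel A)"
    and A: "path_image (rectpath a c) \<subseteq> A"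
    and B: "\<And>z. z \<in> path_image (rectpath a c) \<Longrightarrow> cmod (h z) \<le> B"
    and g: "\<And>z. z \<in> path_image (rectpath a c) \<Longrightarrow> g z = F z / (z - \<theta>) - h z"
  shows "g contour_integrable_on rectpath a c"
    and "cmod (F \<theta> - 1 / (2 * of_real pi * \<i>) * contour_integral (rectpath a c) g)
           \<le> B * (Re c - Re a + (Im c - Im a)) / pi"
proof -
  have le: "Re a < Re c" "Im a < Im c" using \<theta> by (auto simp: in_box_complex_iff)
  have "((\<lambda>z. F z / (z - \<theta>)) has_contour_integral
      2 * pi * \<i> * winding_number (rectpath a c) \<theta> * F \<theta>) (rectpath a c)"
    using \<theta> F le
    by (intro Cauchy_integral_formula_convex_simple[of UNIV])
       (auto simp: path_image_rectpath_cbox_minus_box)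
  then have 1: "((\<lambda>z. F z / (z - \<theta>)) has_contour_integral 2 * pi * \<i> * F \<theta>) (rectpath a c)"
    using \<theta> by (simp add: winding_number_rectpath)
  note bounded = contour_integral_rectpath_bounded[OF h A B]
  have "((\<lambda>z. F z / (z - \<theta>) - h z) has_contour_integral
      2 * pi * \<i> * F \<theta> - contour_integral (rectpath a c) h) (rectpath a c)"
    by (intro has_contour_integral_diff 1 has_contour_integral_integral bounded)
  then have 2: "(g has_contour_integral
      2 * pi * \<i> * F \<theta> - contour_integral (rectpath a c) h) (rectpath a c)"
    by (rule has_contour_integral_eq) (simp add: g)
  then show "g contour_integrable_on rectpath a c"
    by (rule has_contour_integral_integrable)
  have "F \<theta> - 1 / (2 * of_real pi * \<i>) * contour_integral (rectpath a c) g
      = 1 / (2 * of_real pi * \<i>) * contour_integral (rectpath a c) h"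
    by (simp add: contour_integral_unique[OF 2] field_simps)
  then have "cmod (F \<theta> - 1 / (2 * of_real pi * \<i>) * contour_integral (rectpath a c) g)
      = cmod (contour_integral (rectpath a c) h) / (2 * pi)"
    by (simp add: norm_mult norm_divide)
  also have "\<dots> \<le> (B * (2 * \<bar>Re c - Re a\<bar> + 2 * \<bar>Im c - Im a\<bar>)) / (2 * pi)"
    by (intro divide_right_mono bounded) auto
  \<comment> \<open>The perimeter over 2 pi is the half-perimeter over pi.\<close>
  also have "\<dots> = B * (Re c - Re a + (Im c - Im a)) / pi"
    using le by (simp add: field_simps)
  finally show "cmod (F \<theta> - 1 / (2 * of_real pi * \<i>) * contour_integral (rectpath a c) g)
           \<le> B * (Re c - Re a + (Im c - Im a)) / pi" .
qed

text \<open>Embedding coefficients are specified by real angles only, while the contour leaves the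
  real axis. The reals accumulate at 0, so the identity theorem applies.\<close>

lemma entire_eq_on_reals:
  assumes "f holomorphic_on UNIV" "g holomorphic_on UNIV"
    and "\<And>x::real. f (of_real x) = g (of_real x)"
  shows "f z = g z"
proof -
  have "0 islimpt (\<real> :: complex set)"
  proof (rule islimptI)
    fix T :: "complex set" assume "0 \<in> T" "open T"
    then obtain e where e: "e > 0" "ball 0 e \<subseteq> T" by (meson openE)
    then have "of_real (e / 2) \<in> T" by (auto simp: subset_iff)
    with e show "\<exists>y\<in>\<real>. y \<in> T \<and> y \<noteq> 0"
      by (intro bexI[of _ "of_real (e / 2)"]) auto
  qed
  moreover have "(\<lambda>z. f z - g z) holomorphic_on UNIV"
    using assms by (intro holomorphic_intros)
  ultimately have "f z - g z = 0"
    using assms(3)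
    by (intro analytic_continuation[of "\<lambda>z. f z - g z" UNIV \<real> 0 z]) (auto elim!: Reals_cases)
  then show ?thesis by simp
qed

section \<open>Positivity of p and distances between poles\<close>

text \<open>\<open>LEAST\<close> has the required property once some number does; the witness is the
  product of denominators of all the angles.\<close>

lemma angle_denom_pos:
  assumes "rational_polygon vs"
  shows "angle_denom vs > 0"
proof -
  define P where "P p \<longleftrightarrow> 0 < p \<and> (\<forall>j<length vs. \<exists>q::int. ext_angle vs j = of_int q * (pi / real p))"
    for p :: nat
  have "\<forall>j<length vs. \<exists>d::nat. \<exists>q::int. 0 < d \<and> ext_angle vs j = of_int q * (pi / real d)"
  proof (intro allI impI)
    fix j assume "j < length vs"
    then have "ext_angle vs j / pi \<in> \<rat>" using assms by (simp add: rational_polygon_def)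
    then obtain q d :: int where "d > 0" "ext_angle vs j / pi = of_int q / of_int d"
      by (metis Rats_cases')
    then have "0 < nat d \<and> ext_angle vs j = of_int q * (pi / real (nat d))"
      by (simp add: field_simps)
    then show "\<exists>d::nat. \<exists>q::int. 0 < d \<and> ext_angle vs j = of_int q * (pi / real d)" by blast
  qed
  then obtain d :: "nat \<Rightarrow> nat" and q :: "nat \<Rightarrow> int" where
    dq: "\<And>j. j < length vs \<Longrightarrow> 0 < d j \<and> ext_angle vs j = of_int (q j) * (pi / real (d j))"
    by metis
  have "P (\<Prod>j<length vs. d j)"
    unfolding P_def
  proof (intro conjI allI impI)
    show "0 < (\<Prod>j<length vs. d j)" using dq by (intro prod_pos) auto
    fix j assume j: "j < length vs"
    define r where "r = (\<Prod>i\<in>{..<length vs} - {j}. d i)"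
    have "(\<Prod>i<length vs. d i) = d j * r" using j unfolding r_def by (intro prod.remove) auto
    moreover have "r > 0" using dq unfolding r_def by (intro prod_pos) auto
    ultimately have "ext_angle vs j = of_int (q j * int r) * (pi / real (\<Prod>i<length vs. d i))"
      using dq[OF j] by (simp add: field_simps)
    then show "\<exists>m::int. ext_angle vs j = of_int m * (pi / real (\<Prod>i<length vs. d i))" by blast
  qed
  then have "P (LEAST p. P p)" by (rule LeastI)
  then show ?thesis by (simp add: P_def angle_denom_def)
qed

lemma dist_2pi_le: "dist_2pi z w \<le> cmod (z - w)"
  unfolding dist_2pi_def
  by (rule cINF_lower2[where x = 0]) (auto intro!: bdd_belowI[where m = 0])

lemma round_multiple:
  assumes "d > (0::real)"
  shows "\<exists>n::int. \<bar>x - of_int n * d\<bar> \<le> d / 2"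
proof
  have "\<bar>of_int (round (x / d)) - x / d\<bar> \<le> 1/2" by (rule of_int_round_abs_le)
  then have "\<bar>of_int (round (x / d)) - x / d\<bar> * d \<le> 1/2 * d"
    using assms by (intro mult_right_mono) auto
  also have "\<bar>of_int (round (x / d)) - x / d\<bar> * d = \<bar>x - of_int (round (x / d)) * d\<bar>"
    using assms by (simp add: abs_if field_simps split: if_splits)
  finally show "\<bar>x - of_int (round (x / d)) * d\<bar> \<le> d / 2" by simp
qed

text \<open>Vanishing at t identifies the constant term of \<Lambda> with cos (p t), which removes
  both \<alpha> and the sign.\<close>

lemma \<Lambda>_pole:
  assumes "of_real t \<in> \<Theta> p \<alpha>"
  shows "\<Lambda> p z \<alpha> = cos (of_nat p * z) - of_real (cos (real p * t))"
proof -
  have "(-1) ^ p * of_real (cos (real p * \<alpha>)) = cos (of_real (real p * t) :: complex)"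
    using assms by (simp add: \<Theta>_def \<Lambda>_def)
  then show ?thesis by (simp add: \<Lambda>_def cos_of_real del: of_real_mult)
qed

text \<open>Each bound compares a minimising pole with an explicit competitor: a translate of
  \<open>\<theta>\<^sub>0\<close> by a multiple of 2 pi / p, or such a translate of its
  reflection.\<close>

lemma nearby_poles_dist:
  assumes "nearby_poles p \<theta> \<alpha> \<theta>\<^sub>0 \<theta>\<^sub>0'" "p > 0"
  shows "\<bar>\<theta> - \<theta>\<^sub>0\<bar> \<le> pi / p" "\<bar>\<theta>\<^sub>0' - \<theta>\<^sub>0\<bar> \<le> pi / p"
proof -
  have t0: "of_real \<theta>\<^sub>0 \<in> \<Theta> p \<alpha>"
    and near: "\<And>t. t \<in> \<Theta> p \<alpha> \<Longrightarrow> \<bar>\<theta> - \<theta>\<^sub>0\<bar> \<le> dist_2pi (of_real \<theta>) t"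
    using assms(1) by (auto simp: nearby_poles_def)
  have pole: "of_real t \<in> \<Theta> p \<alpha> \<longleftrightarrow> cos (real p * t) = cos (real p * \<theta>\<^sub>0)" for t
  proof -
    have "\<Lambda> p (of_real t) \<alpha> = of_real (cos (real p * t) - cos (real p * \<theta>\<^sub>0))"
      unfolding \<Lambda>_pole[OF t0] by (simp flip: cos_of_real)
    then show ?thesis by (simp add: \<Theta>_def del: of_real_diff)
  qed
  have d: "2 * pi / p > 0" using assms(2) by simp
  have dist: "dist_2pi (of_real x) (of_real y) \<le> \<bar>x - y\<bar>" for x y
    using dist_2pi_le[of "of_real x" "of_real y"] by (simp flip: of_real_diff)
  show "\<bar>\<theta> - \<theta>\<^sub>0\<bar> \<le> pi / p"
  proof -
    obtain n :: int where n: "\<bar>(\<theta> - \<theta>\<^sub>0) - of_int n * (2 * pi / p)\<bar> \<le> pi / p"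
      using round_multiple[OF d, of "\<theta> - \<theta>\<^sub>0"] by auto
    let ?t = "\<theta>\<^sub>0 + of_int n * (2 * pi / p)"
    have "real p * ?t = real p * \<theta>\<^sub>0 + of_int n * (2 * pi)"
      using assms(2) by (simp add: field_simps)
    then have "of_real ?t \<in> \<Theta> p \<alpha>"
      unfolding pole by (simp only: cos_plus_of_int_2pi)
    from near[OF this] dist[of \<theta> ?t] n show ?thesis by (simp add: algebra_simps)
  qed
  show "\<bar>\<theta>\<^sub>0' - \<theta>\<^sub>0\<bar> \<le> pi / p"
  proof (cases "\<exists>n::int. \<theta>\<^sub>0 = of_int n * pi / real p")
    case True
    then show ?thesis using assms by (simp add: nearby_poles_def)
  next
    case False
    define others where "others = {t \<in> \<Theta> p \<alpha>. \<forall>n::int. t \<noteq> of_real (\<theta>\<^sub>0 + 2 * of_int n * pi)}"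
    have near': "\<bar>\<theta>\<^sub>0 - \<theta>\<^sub>0'\<bar> \<le> dist_2pi (of_real \<theta>\<^sub>0) t" if "t \<in> others" for t
      using assms(1) False that unfolding nearby_poles_def others_def Let_def by auto
    obtain n :: int where n: "\<bar>2 * \<theta>\<^sub>0 - of_int n * (2 * pi / p)\<bar> \<le> pi / p"
      using round_multiple[OF d, of "2 * \<theta>\<^sub>0"] by auto
    let ?t = "- \<theta>\<^sub>0 + of_int n * (2 * pi / p)"
    have "real p * ?t = - (real p * \<theta>\<^sub>0) + of_int n * (2 * pi)"
      using assms(2) by (simp add: field_simps)
    then have "of_real ?t \<in> \<Theta> p \<alpha>"
      unfolding pole by (simp only: cos_plus_of_int_2pi cos_minus)
    \<comment> \<open>The reflected pole is admissible: coincidence modulo 2 pi would make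
      \<open>\<theta>\<^sub>0\<close> a multiple of pi / p, which this case excludes.\<close>
    moreover have "?t \<noteq> \<theta>\<^sub>0 + 2 * of_int k * pi" for k :: int
    proof
      assume "?t = \<theta>\<^sub>0 + 2 * of_int k * pi"
      then have "\<theta>\<^sub>0 = of_int (n - k * int p) * pi / p"
        using assms(2) by (simp add: field_simps)
      with False show False by blast
    qed
    ultimately have "of_real ?t \<in> others"
      unfolding others_def using of_real_eq_iff by blast
    from near'[OF this] dist[of \<theta>\<^sub>0 ?t] n show ?thesis by (simp add: algebra_simps abs_minus_commute)
  qed
qed

section \<open>Choice of the contour and bounds on it\<close>

text \<open>
  The constant leaves so much room that the contour need not stay close to the poles. Working in the
  variable p z, its horizontal sides lie at height 1, where cosh gives a lower bound for the
  denominator. Its vertical sides lie where \<open>cos (p Re z) = \<plusminus>1\<close> has the sign opposite to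
  \<open>cos (p \<theta>\<^sub>0)\<close>, so that no cancellation occurs in \<open>cos (p z) - cos (p \<theta>\<^sub>0)\<close>.
\<close>

lemma ex_rectangle_avoiding_poles:
  assumes p: "p > 0" and t0: "of_real t\<^sub>0 \<in> \<Theta> p \<alpha>"
  obtains a c where
    "Im a = - (1 / p)" "Im c = 1 / p" "Re c - Re a \<le> (6 * pi + 2) / p"
    "\<And>x. \<bar>x - t\<^sub>0\<bar> \<le> pi / p \<Longrightarrow> of_real x \<in> box a c"
    "\<And>x z. \<bar>x - t\<^sub>0\<bar> \<le> pi / p \<Longrightarrow> z \<in> path_image (rectpath a c) \<Longrightarrow> 1 / p \<le> cmod (z - of_real x)"
    "\<And>z. z \<in> path_image (rectpath a c) \<Longrightarrow> \<bar>Im z\<bar> \<le> 1 / p \<and> 5/12 \<le> cmod (\<Lambda> p z \<alpha>)"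
proof -
  define C where "C = cos (real p * t\<^sub>0)"
  obtain t where t: "\<bar>cos t\<bar> = 1" "cos t * C \<le> 0"
  proof (cases "C \<ge> 0")
    case True
    then show ?thesis by (intro that[of pi]) auto
  next
    case False
    then show ?thesis by (intro that[of 0]) auto
  qed
  \<comment> \<open>The inner margin pi + 1 covers every x within pi / p of \<open>t\<^sub>0\<close>
    and leaves distance 1 in the variable p z. A full period beyond it contains a suitable abscissa,
    hence the width bound 6 pi + 2.\<close>
  obtain u where u: "real p * t\<^sub>0 - 3 * pi - 1 \<le> u" "u \<le> real p * t\<^sub>0 - pi - 1" "cos u = cos t"
    using cos_eq_in_period[of "real p * t\<^sub>0 - 3 * pi - 1" t] by auto
  obtain v where v: "real p * t\<^sub>0 + pi + 1 \<le> v" "v \<le> real p * t\<^sub>0 + 3 * pi + 1" "cos v = cos t"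
    using cos_eq_in_period[of "real p * t\<^sub>0 + pi + 1" t] by auto
  define a c where "a = Complex (u / p) (- (1 / p))" and "c = Complex (v / p) (1 / p)"
  have le: "Re a \<le> Re c" "Im a \<le> Im c"
    using p u v pi_gt_zero by (simp_all add: a_def c_def divide_right_mono)
  have near: "real p * x \<ge> real p * t\<^sub>0 - pi" "real p * x \<le> real p * t\<^sub>0 + pi"
    if "\<bar>x - t\<^sub>0\<bar> \<le> pi / p" for x
  proof -
    have "real p * \<bar>x - t\<^sub>0\<bar> \<le> pi"
      using that p by (simp add: field_simps)
    then have "\<bar>real p * x - real p * t\<^sub>0\<bar> \<le> pi"
      by (simp add: abs_mult flip: right_diff_distrib)
    then show "real p * x \<ge> real p * t\<^sub>0 - pi" "real p * x \<le> real p * t\<^sub>0 + pi" by linarith+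
  qed
  have sides: "real p * Re z = u \<or> real p * Re z = v \<or> \<bar>real p * Im z\<bar> = 1"
    and Im_le: "\<bar>Im z\<bar> \<le> 1 / p" if "z \<in> path_image (rectpath a c)" for z
    using that p unfolding path_image_rectpath[OF le] by (auto simp: a_def c_def)
  show ?thesis
  proof (rule that)
    show "Re c - Re a \<le> (6 * pi + 2) / p"
      unfolding a_def c_def complex.sel diff_divide_distrib[symmetric]
      using u v by (intro divide_right_mono) auto
    show "Im a = - (1 / p)" "Im c = 1 / p" by (simp_all add: a_def c_def)
  next
    fix x assume "\<bar>x - t\<^sub>0\<bar> \<le> pi / p"
    then show "of_real x \<in> box a c"
      using near[of x] u v p by (simp add: in_box_complex_iff a_def c_def field_simps)
  next
    fix x z assume x: "\<bar>x - t\<^sub>0\<bar> \<le> pi / p" and z: "z \<in> path_image (rectpath a c)"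
    let ?w = "of_nat p * (z - of_real x)"
    \<comment> \<open>Vertical sides have the margin 1; on horizontal sides x is real, so the
      imaginary part of \<open>?w\<close> is 1 or -1.\<close>
    have "1 \<le> \<bar>Re ?w\<bar> \<or> 1 \<le> \<bar>Im ?w\<bar>"
      using sides[OF z] near[OF x] u v by (auto simp: right_diff_distrib)
    then have "1 \<le> cmod ?w"
      using abs_Re_le_cmod[of ?w] abs_Im_le_cmod[of ?w] by linarith
    then show "1 / p \<le> cmod (z - of_real x)"
      using p unfolding norm_mult norm_of_nat by (simp add: divide_le_eq mult.commute)
  next
    fix z assume z: "z \<in> path_image (rectpath a c)"
    let ?w = "of_nat p * z"
    have \<Lambda>: "\<Lambda> p z \<alpha> = cos ?w - of_real C"
      unfolding C_def by (rule \<Lambda>_pole[OF t0])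
    from sides[OF z] have "5/12 \<le> cmod (cos ?w - of_real C)"
    proof (elim disjE)
      assume "\<bar>real p * Im z\<bar> = 1"
      \<comment> \<open>Here 5/12 = 17/12 - 1; the vertical sides give the larger bound 1.\<close>
      then have "cosh (Im ?w) = cosh 1" by (auto simp: abs_if split: if_splits)
      moreover have "cosh (Im ?w) - 1 \<le> cmod (cos ?w - of_real C)"
        by (rule cmod_cos_diff_ge_cosh) (simp add: C_def)
      ultimately show ?thesis
        using cosh_one_bounds(1) by linarith
    qed (use cmod_cos_diff_ge_one[of ?w C] t u v in \<open>simp_all\<close>)
    then show "\<bar>Im z\<bar> \<le> 1 / p \<and> 5/12 \<le> cmod (\<Lambda> p z \<alpha>)"
      using Im_le[OF z] \<Lambda> by simp
  qed
qed

text \<open>At heights up to 1 in p z the complex cosine is at most cosh 1 <= 5/3, and the constant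
  term adds at most 1.\<close>

lemma cmod_\<Lambda>_le:
  assumes "p > 0" "\<bar>Im z\<bar> \<le> 1 / p"
  shows "cmod (\<Lambda> p z \<beta>) \<le> 8/3"
proof -
  have "real p * \<bar>Im z\<bar> \<le> 1" using assms by (simp add: field_simps)
  then have "cosh (real p * \<bar>Im z\<bar>) \<le> cosh 1"
    by (subst cosh_real_nonneg_le_iff) auto
  moreover have "cosh (real p * \<bar>Im z\<bar>) = cosh (real p * Im z)"
    by (simp add: abs_if)
  ultimately have "cosh (real p * Im z) \<le> 5/3"
    using cosh_one_bounds(2) by linarith
  then have "cmod (cos (of_nat p * z)) \<le> 5/3"
    using cmod_cos_le_cosh[of "of_nat p * z"] by simp
  moreover have "cmod ((-1) ^ p * of_real (cos (real p * \<beta>))) \<le> 1"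
    by (simp add: norm_mult norm_power)
  ultimately show ?thesis
    unfolding \<Lambda>_def using norm_triangle_ineq4[of "cos (of_nat p * z)" "(-1) ^ p * of_real (cos (real p * \<beta>))"]
    by linarith
qed

lemma \<Lambda>_holomorphic [holomorphic_intros]: "(\<lambda>z. \<Lambda> p z \<alpha>) holomorphic_on A"
  unfolding \<Lambda>_def by (intro holomorphic_intros)

text \<open>The left side is what this contour yields: 32/5 = (8/3) / (5/12), and 6 pi + 4 bounds p
  times the half-perimeter. The number 60 separates the two sides, using pi > 3 on the left and 3840
  / pi^3 >= 60 from pi < 4 on the right.\<close>

lemma numerical_constant_bound:
  "32/5 * (6 * pi + 4) / pi
     \<le> 128 * (5 * pi + 4 * ln (3 + pi\<^sup>2 / 64)) * (6 + pi\<^sup>2 / 64) / pi ^ 4"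
proof -
  have "ln (3 + pi\<^sup>2 / 64) \<ge> 0" by (intro ln_ge_zero) (simp add: add_increasing2)
  then have "128 * (5 * pi) * 6 \<le> 128 * (5 * pi + 4 * ln (3 + pi\<^sup>2 / 64)) * (6 + pi\<^sup>2 / 64)"
    by (intro mult_mono) auto
  then have "128 * (5 * pi) * 6 / pi ^ 4
      \<le> 128 * (5 * pi + 4 * ln (3 + pi\<^sup>2 / 64)) * (6 + pi\<^sup>2 / 64) / pi ^ 4"
    by (intro divide_right_mono) auto
  moreover have "60 \<le> 128 * (5 * pi) * 6 / pi ^ 4"
  proof -
    have "pi ^ 3 \<le> 4 ^ 3" using pi_less_4 by (intro power_mono) auto
    then have "60 * pi ^ 3 * pi \<le> 3840 * pi" by simp
    then show ?thesis by (simp add: field_simps power_eq_if[of pi 4] power3_eq_cube)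
  qed
  moreover have "32/5 * (6 * pi + 4) / pi \<le> 60"
    using pi_gt3 by (simp add: field_simps)
  ultimately show ?thesis by linarith
qed

section \<open>The error estimate\<close>

theorem theorem2p3:
  fixes vs :: "complex list" and p M :: nat and k :: real
    and us :: "real \<Rightarrow> complex \<Rightarrow> complex" and D D\<^sub>N :: "complex \<Rightarrow> real \<Rightarrow> complex"
    and am :: "nat \<Rightarrow> real" and b :: "nat \<Rightarrow> complex" and \<epsilon> :: "nat \<Rightarrow> real"
    and \<theta> \<alpha> \<theta>\<^sub>0 \<theta>\<^sub>0' :: real
  assumes "rational_polygon vs" and "has_horizontal_edge vs"
    and "p = angle_denom vs"
    and "int M = (\<Sum>j<length vs. angle_num vs j - 1)"
    and "k > 0"
    and "\<And>\<beta>. \<beta> \<in> {0..<2*pi} \<Longrightarrow> scattered_field k (polygon_region vs) \<beta> (us \<beta>)"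
    and "\<And>\<beta>. \<beta> \<in> {0..<2*pi} \<Longrightarrow> has_far_field k (us \<beta>) (\<lambda>\<phi>. D (of_real \<phi>) \<beta>)"
    and "\<And>\<beta>. \<beta> \<in> {0..<2*pi} \<Longrightarrow> (\<lambda>z. D z \<beta>) holomorphic_on UNIV"
    and "am ` {1..M} \<subseteq> {0..<2*pi}" and "inj_on am {1..M}"
    and "\<theta> \<in> {0..<2*pi}" and "\<alpha> \<in> {0..<2*pi}"
    and "embedding_coeffs p M D am \<alpha> b"
    and "nearby_poles p \<theta> \<alpha> \<theta>\<^sub>0 \<theta>\<^sub>0'"
    and "\<And>m. m \<in> {1..M} \<Longrightarrow> (\<lambda>z. D\<^sub>N z (am m)) \<in> borel_measurable (restrict_space borel (\<Psi> p))"
    and "\<And>m z. m \<in> {1..M} \<Longrightarrow> z \<in> \<Psi> p \<Longrightarrow> cmod (D z (am m) - D\<^sub>N z (am m)) \<le> \<epsilon> m"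
  shows "\<exists>\<gamma> a c. Re a < Re c \<and> Im a < Im c \<and> \<gamma> = rectpath a c \<and>
           path_image \<gamma> \<subseteq> \<Psi> p - \<Theta> p \<alpha> \<and>
           {of_real \<theta>, of_real \<theta>\<^sub>0, of_real \<theta>\<^sub>0'} \<subseteq> inside (path_image \<gamma>) \<and>
           embedding_integrand p M D\<^sub>N am b \<theta> \<alpha> contour_integrable_on \<gamma> \<and>
           cmod (D (of_real \<theta>) \<alpha> - embedding_approx p M D\<^sub>N am b \<theta> \<alpha> \<gamma>)
             \<le> 128 * (5 * pi + 4 * ln (3 + pi\<^sup>2 / 64)) * (6 + pi\<^sup>2 / 64) / pi ^ 4
                 * L2_set (\<lambda>m. cmod (b m)) {1..M} * L2_set \<epsilon> {1..M}"
proof -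
  have p: "p > 0" using assms(1,3) angle_denom_pos by simp
  have t0: "of_real \<theta>\<^sub>0 \<in> \<Theta> p \<alpha>" using assms(14) by (simp add: nearby_poles_def)
  obtain a c where Im_ac: "Im a = - (1 / p)" "Im c = 1 / p"
    and width: "Re c - Re a \<le> (6 * pi + 2) / p"
    and box: "\<And>x. \<bar>x - \<theta>\<^sub>0\<bar> \<le> pi / p \<Longrightarrow> of_real x \<in> box a c"
    and far: "\<And>x z. \<bar>x - \<theta>\<^sub>0\<bar> \<le> pi / p \<Longrightarrow> z \<in> path_image (rectpath a c) \<Longrightarrow> 1 / p \<le> cmod (z - of_real x)"
    and path: "\<And>z. z \<in> path_image (rectpath a c) \<Longrightarrow> \<bar>Im z\<bar> \<le> 1 / p \<and> 5/12 \<le> cmod (\<Lambda> p z \<alpha>)"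
    by (rule ex_rectangle_avoiding_poles[OF p t0]) (rule that; blast)
  note dist = nearby_poles_dist[OF assms(14) p]
  have inside: "of_real \<theta> \<in> box a c" "of_real \<theta>\<^sub>0 \<in> box a c" "of_real \<theta>\<^sub>0' \<in> box a c"
    using p dist by (auto intro: box)
  have less: "Re a < Re c" "Im a < Im c"
    using inside by (auto simp: in_box_complex_iff)
  \<comment> \<open>Since e <= 3, the strip has half-height above 1 / p, so the rectangle fits
    inside it.\<close>
  have "exp 1 < 3 + pi\<^sup>2 / 64" using exp_le by (rule le_less_trans) simp
  then have "ln (exp 1) < ln (3 + pi\<^sup>2 / 64)"
    by (subst ln_less_cancel_iff) (auto intro: add_pos_pos)
  then have \<Psi>: "z \<in> \<Psi> p" if "\<bar>Im z\<bar> \<le> 1 / p" for z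
    using that p by (auto simp: \<Psi>_def intro!: le_less_trans[OF that] divide_strict_right_mono)
  then have sub\<Psi>: "path_image (rectpath a c) \<subseteq> \<Psi> p" using path by blast
  have "\<Lambda> p z \<alpha> \<noteq> 0" if "z \<in> path_image (rectpath a c)" for z
    using path[OF that] by auto
  then have sub: "path_image (rectpath a c) \<subseteq> \<Psi> p - \<Theta> p \<alpha>"
    using sub\<Psi> by (auto simp: \<Theta>_def)

  have Dholo: "(\<lambda>z. D z \<alpha>) holomorphic_on UNIV" using assms(8,12) by blast
  have Dmholo: "(\<lambda>z. D z (am m)) holomorphic_on UNIV" if "m \<in> {1..M}" for m
    using assms(8,9) that by blast
  have embed: "\<Lambda> p z \<alpha> * D z \<alpha> = (\<Sum>m=1..M. b m * \<Lambda> p z (am m) * D z (am m))" for z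
    using assms(13) Dholo Dmholo
    by (intro entire_eq_on_reals[where z = z and f = "\<lambda>z. \<Lambda> p z \<alpha> * D z \<alpha>"] holomorphic_intros)
       (auto simp: embedding_coeffs_def)

  define S where "S = L2_set (\<lambda>m. cmod (b m)) {1..M} * L2_set \<epsilon> {1..M}"
  have "S \<ge> 0" by (simp add: S_def L2_set_nonneg)
  \<comment> \<open>\<open>num\<close> is the error of the numerator of the integrand and
    \<open>h\<close> that of the integrand itself.\<close>
  define num where "num z = (\<Sum>m=1..M. b m * \<Lambda> p z (am m) * (D z (am m) - D\<^sub>N z (am m)))" for z
  define h where "h z = num z / (\<Lambda> p z \<alpha> * (z - of_real \<theta>))" for z

  have hmeas: "h \<in> borel_measurable (restrict_space borel (\<Psi> p))"
  proof -
    have meas: "f \<in> borel_measurable (restrict_space borel (\<Psi> p))" if "f holomorphic_on UNIV" for f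
      using that
      by (intro measurable_restrict_space1 borel_measurable_continuous_onI holomorphic_on_imp_continuous_on)
    show ?thesis
      unfolding h_def num_def
      by (intro borel_measurable_divide borel_measurable_sum borel_measurable_times
          borel_measurable_diff assms(15) Dmholo meas holomorphic_intros)
  qed
  have hbound: "cmod (h z) \<le> 32/5 * real p * S" if z: "z \<in> path_image (rectpath a c)" for z
  proof -
    \<comment> \<open>The absolute values match the form of Cauchy-Schwarz in
      \<open>L2_set_mult_ineq\<close>.\<close>
    have "cmod (num z) \<le> (\<Sum>m=1..M. 8/3 * (\<bar>cmod (b m)\<bar> * \<bar>\<epsilon> m\<bar>))"
      unfolding num_def
    proof (rule sum_norm_le)
      fix m assume m: "m \<in> {1..M}"
      have "cmod (D z (am m) - D\<^sub>N z (am m)) \<le> \<bar>\<epsilon> m\<bar>"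
        using assms(16)[OF m] z sub\<Psi> by fastforce
      moreover have "cmod (\<Lambda> p z (am m)) \<le> 8/3"
        using cmod_\<Lambda>_le p path[OF z] by blast
      ultimately have "cmod (b m) * (cmod (\<Lambda> p z (am m)) * cmod (D z (am m) - D\<^sub>N z (am m)))
          \<le> cmod (b m) * (8/3 * \<bar>\<epsilon> m\<bar>)"
        by (intro mult_left_mono mult_mono) auto
      then show "cmod (b m * \<Lambda> p z (am m) * (D z (am m) - D\<^sub>N z (am m))) \<le> 8/3 * (\<bar>cmod (b m)\<bar> * \<bar>\<epsilon> m\<bar>)"
        by (simp add: norm_mult mult_ac)
    qed
    also have "\<dots> \<le> 8/3 * S"
      unfolding S_def sum_distrib_left[symmetric] by (intro mult_left_mono L2_set_mult_ineq) auto
    finally have num: "cmod (num z) \<le> 8/3 * S" .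
    have "5/12 * (1 / p) \<le> cmod (\<Lambda> p z \<alpha>) * cmod (z - of_real \<theta>)"
      using path[OF z] far[OF dist(1) z] by (intro mult_mono) auto
    \<comment> \<open>The distance 1 / p from \<theta> costs a factor p, which the perimeter, of
      order 1 / p, later cancels.\<close>
    then have "cmod (h z) \<le> (8/3 * S) / (5/12 * (1 / p))"
      unfolding h_def norm_divide norm_mult using num p \<open>S \<ge> 0\<close> by (intro frac_le) auto
    then show ?thesis by (simp add: field_simps)
  qed
  have split: "embedding_integrand p M D\<^sub>N am b \<theta> \<alpha> z = D z \<alpha> / (z - of_real \<theta>) - h z"
    if "z \<in> path_image (rectpath a c)" for z
  proof -
    \<comment> \<open>By \<open>embed\<close> the exact numerator is \<Lambda> D, so dividing by
      \<Lambda>, nonzero on the contour, leaves the Cauchy kernel of D.\<close>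
    have "num z = \<Lambda> p z \<alpha> * D z \<alpha> - (\<Sum>m=1..M. b m * \<Lambda> p z (am m) * D\<^sub>N z (am m))"
      by (simp add: num_def embed right_diff_distrib sum_subtractf)
    moreover have "\<Lambda> p z \<alpha> \<noteq> 0" using path[OF that] by auto
    ultimately show ?thesis
      by (simp add: embedding_integrand_def h_def diff_divide_distrib)
  qed
  note Cauchy = Cauchy_rectpath_perturbed[OF Dholo inside(1) hmeas sub\<Psi> hbound split]
  have "cmod (D (of_real \<theta>) \<alpha> - embedding_approx p M D\<^sub>N am b \<theta> \<alpha> (rectpath a c))
      \<le> 32/5 * real p * S * (Re c - Re a + (Im c - Im a)) / pi"
    unfolding embedding_approx_def by (rule Cauchy(2))
  also have "\<dots> \<le> 32/5 * real p * S * ((6 * pi + 4) / p) / pi"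
    using width \<open>S \<ge> 0\<close> by (intro divide_right_mono mult_left_mono) (simp_all add: Im_ac add_divide_distrib)
  also have "\<dots> = 32/5 * (6 * pi + 4) / pi * S"
    using p by simp
  also have "\<dots> \<le> 128 * (5 * pi + 4 * ln (3 + pi\<^sup>2 / 64)) * (6 + pi\<^sup>2 / 64) / pi ^ 4 * S"
    using \<open>S \<ge> 0\<close> by (intro mult_right_mono numerical_constant_bound)
  finally have "cmod (D (of_real \<theta>) \<alpha> - embedding_approx p M D\<^sub>N am b \<theta> \<alpha> (rectpath a c))
      \<le> 128 * (5 * pi + 4 * ln (3 + pi\<^sup>2 / 64)) * (6 + pi\<^sup>2 / 64) / pi ^ 4
        * L2_set (\<lambda>m. cmod (b m)) {1..M} * L2_set \<epsilon> {1..M}"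
    by (simp add: S_def mult.assoc)
  moreover have "{of_real \<theta>, of_real \<theta>\<^sub>0, of_real \<theta>\<^sub>0'} \<subseteq> inside (path_image (rectpath a c))"
    using inside by (simp add: inside_path_image_rectpath[OF less])
  moreover have "embedding_integrand p M D\<^sub>N am b \<theta> \<alpha> contour_integrable_on rectpath a c"
    by (rule Cauchy(1))
  ultimately show ?thesis
    using less sub by (intro exI[of _ "rectpath a c"] exI[of _ a] exI[of _ c]) simp
qed

end
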